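(* Let $a,b,c,d,q$ be indeterminates and define polynomials $F_m(y)$ by $F_0(y)=1$, $F_m(y)=0$ for $m<0$, and for $m>0$ $$F_m(y)=\big(b+d-y(a+c)q^{m-1}\big)F_{m-1}(y)+(q^{m-1}-1)\big(bd-acq^{m-2}y^2\big)F_{m-2}(y).$$ Then for all $m\ge0$, $$F_m(y)=\sum_{i=0}^m(-1)^i\begin{bmatrix}m\\ i\end{bmatrix}_q q^{\binom i2}y^iA_i(a,c)B_{m-i}(b,d),$$ where $B_m(b,d)=\sum_{i=0}^m\begin{bmatrix}m\\ i\end{bmatrix}_q b^id^{m-i}$ and $A_m(a,c)=\sum_{i=0}^m\begin{bmatrix}m\\ i\end{bmatrix}_{1/q}a^ic^{m-i}$.
   Context: The $q$-binomial coefficient is $\begin{bmatrix}m\\ i\end{bmatrix}_q=\frac{[m]_q!}{[i]_q![m-i]_q!}$ with $[k]_q!=\prod_{j=1}^k(1+q+\dots+q^{j-1})$; $\begin{bmatrix}m\\ i\end{bmatrix}_{1/q}$ is the same with $q$ replaced by $q^{-1}$. *)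

theory Defs
  imports "HOL-Computational_Algebra.Computational_Algebra"
begin

definition qfact :: "'a::field \<Rightarrow> nat \<Rightarrow> 'a" where
  "qfact q k = (\<Prod>j=1..k. \<Sum>l<j. q ^ l)"

definition qbinom :: "'a::field \<Rightarrow> nat \<Rightarrow> nat \<Rightarrow> 'a" where
  "qbinom q m i = qfact q m / (qfact q i * qfact q (m - i))"

definition polyB :: "'a::field \<Rightarrow> nat \<Rightarrow> 'a \<Rightarrow> 'a \<Rightarrow> 'a" where
  "polyB q m b d = (\<Sum>i=0..m. qbinom q m i * b ^ i * d ^ (m - i))"

definition polyA :: "'a::field \<Rightarrow> nat \<Rightarrow> 'a \<Rightarrow> 'a \<Rightarrow> 'a" where
  "polyA q m a c = (\<Sum>i=0..m. qbinom (1 / q) m i * a ^ i * c ^ (m - i))"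

text \<open>The polynomial variable of \<open>polyF a b c d q m\<close> is \<open>y\<close>. The index is an integer because
  the recurrence refers to negative indices; for \<open>m = 1\<close> it contains \<open>q\<close> to the power \<open>-1\<close>.\<close>

function polyF :: "'a::field \<Rightarrow> 'a \<Rightarrow> 'a \<Rightarrow> 'a \<Rightarrow> 'a \<Rightarrow> int \<Rightarrow> 'a poly" where
  "polyF a b c d q m =
    (if m < 0 then 0
     else if m = 0 then 1
     else ([:b + d:] - monom ((a + c) * q powi (m - 1)) 1) * polyF a b c d q (m - 1)
        + [:q powi (m - 1) - 1:] * ([:b * d:] - monom (a * c * q powi (m - 2)) 2)
            * polyF a b c d q (m - 2))"
  by pat_completeness auto
termination
  by (relation "measure (\<lambda>(a, b, c, d, q, m). nat (m + 1))") auto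

declare polyF.simps [simp del]

text \<open>The field of rational functions in five indeterminates over (the fraction field of) \<open>'k\<close>.
  The innermost \<open>poly\<close> adjoins \<open>a\<close>, then come \<open>b\<close>, \<open>c\<close>, \<open>d\<close>, and the outermost adjoins \<open>q\<close>.\<close>

type_synonym 'k ratfun5 = "'k poly poly poly poly poly fract"

definition indet_a :: "'k::idom ratfun5" where
  "indet_a = Fract [:[:[:[:[:0, 1:]:]:]:]:] 1"

definition indet_b :: "'k::idom ratfun5" where
  "indet_b = Fract [:[:[:[:0, 1:]:]:]:] 1"

definition indet_c :: "'k::idom ratfun5" where
  "indet_c = Fract [:[:[:0, 1:]:]:] 1"

definition indet_d :: "'k::idom ratfun5" where
  "indet_d = Fract [:[:0, 1:]:] 1"

definition indet_q :: "'k::idom ratfun5" where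
  "indet_q = Fract [:0, 1:] 1"

end

theory Submission
  imports Defs
begin

text \<open>
  Both \<open>B\<close> and \<open>A\<close> are Rogers-Szego polynomials (with parameters \<open>q\<close> and \<open>1/q\<close>) and hence
  satisfy three-term recurrences. Compare coefficients of \<open>y\<^sup>k\<close> in the recurrence for \<open>F\<close>:
  the terms with \<open>b\<close>, \<open>d\<close> collapse by the recurrence for \<open>B\<close> to a multiple of \<open>A\<^sub>k B\<^sub>m\<^sub>-\<^sub>k\<close>, those
  with \<open>a\<close>, \<open>c\<close> collapse by the recurrence for \<open>A\<close> to another multiple of the same product, and
  the two multiples add up by the \<open>q\<close>-Pascal rule.
\<close>

section \<open>Gaussian binomials extended by zero\<close>

text \<open>Beyond the diagonal \<open>qbinom\<close> takes junk values, since \<open>m - i\<close> is truncated there.\<close>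

definition gauss_binom :: "'a::field \<Rightarrow> nat \<Rightarrow> nat \<Rightarrow> 'a" where
  "gauss_binom q n k = (if k \<le> n then qbinom q n k else 0)"

lemma qfact_0 [simp]: "qfact q 0 = 1"
  by (simp add: qfact_def)

lemma gauss_binom_eq_0 [simp]: "n < k \<Longrightarrow> gauss_binom q n k = 0"
  by (simp add: gauss_binom_def)

locale non_root_of_unity =
  fixes q :: "'a::field"
  assumes nonzero: "q \<noteq> 0"
    and power_neq_1: "n > 0 \<Longrightarrow> q ^ n \<noteq> 1"
begin

lemma neq_1: "q \<noteq> 1"
  using power_neq_1[of 1] by simp

lemma non_root_of_unity_inverse: "non_root_of_unity (1 / q)"
  by unfold_locales (use nonzero power_neq_1 in \<open>auto simp: power_divide field_simps\<close>)

lemma qfact_Suc: "qfact q (Suc n) = qfact q n * ((q ^ Suc n - 1) / (q - 1))"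
proof -
  have "(\<Sum>l<Suc n. q ^ l) = (q ^ Suc n - 1) / (q - 1)"
    using geometric_sum[OF neq_1] by blast
  then show ?thesis
    unfolding qfact_def by (simp add: mult.commute)
qed

lemma qfact_nonzero: "qfact q n \<noteq> 0"
proof (induction n)
  case (Suc n)
  then show ?case
    using power_neq_1[of "Suc n"] neq_1 unfolding qfact_Suc by auto
qed simp

lemma gauss_binom_0 [simp]: "gauss_binom q n 0 = 1"
  by (simp add: gauss_binom_def qbinom_def qfact_nonzero)

lemma gauss_binom_diag [simp]: "gauss_binom q n n = 1"
  by (simp add: gauss_binom_def qbinom_def qfact_nonzero)

lemma qfact_ratio_cancel:
  fixes u v w x y z :: 'a
  assumes "u \<noteq> 0" "w \<noteq> 0"
  shows "u * (x * (v / w) / (y * (u / w) * z)) = v * (x / (y * z))"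
  using assms by (cases "y = 0 \<or> z = 0") (auto simp: divide_simps)

lemma gauss_binom_absorb_both:
  "(q ^ Suc k - 1) * gauss_binom q (Suc n) (Suc k) = (q ^ Suc n - 1) * gauss_binom q n k"
proof (cases "k \<le> n")
  case True
  have "q ^ Suc k - 1 \<noteq> 0" "q - 1 \<noteq> 0"
    using power_neq_1[of "Suc k"] neq_1 by auto
  then have "(q ^ Suc k - 1) * (qfact q (Suc n) / (qfact q (Suc k) * qfact q (n - k)))
      = (q ^ Suc n - 1) * (qfact q n / (qfact q k * qfact q (n - k)))"
    unfolding qfact_Suc by (rule qfact_ratio_cancel)
  with True show ?thesis
    by (simp add: gauss_binom_def qbinom_def del: power_Suc)
qed simp

lemma gauss_binom_absorb_upper:
  assumes "k \<le> Suc n"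
  shows "(q ^ (Suc n - k) - 1) * gauss_binom q (Suc n) k = (q ^ Suc n - 1) * gauss_binom q n k"
proof (cases "k \<le> n")
  case True
  have "q ^ Suc (n - k) - 1 \<noteq> 0" "q - 1 \<noteq> 0"
    using power_neq_1[of "Suc (n - k)"] neq_1 by auto
  then have "(q ^ Suc (n - k) - 1) * (qfact q (Suc n) / (qfact q (Suc (n - k)) * qfact q k))
      = (q ^ Suc n - 1) * (qfact q n / (qfact q (n - k) * qfact q k))"
    unfolding qfact_Suc by (rule qfact_ratio_cancel)
  with True show ?thesis
    by (simp add: gauss_binom_def qbinom_def Suc_diff_le mult.commute[of "qfact q k"] del: power_Suc)
next
  case False
  with assms have "k = Suc n" by simp
  then show ?thesis by simp
qed

lemma gauss_binom_Pascal:
  assumes "k \<le> n"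
  shows "gauss_binom q (Suc n) (Suc k) = gauss_binom q n (Suc k) + q ^ (n - k) * gauss_binom q n k"
proof -
  let ?g = "gauss_binom q (Suc n) (Suc k)" and ?u = "q ^ Suc n - 1"
  have u: "?u \<noteq> 0"
    using power_neq_1[of "Suc n"] by simp
  have 1: "?u * gauss_binom q n (Suc k) = (q ^ (n - k) - 1) * ?g"
    using gauss_binom_absorb_upper[of "Suc k" n] assms by simp
  have 2: "?u * gauss_binom q n k = (q ^ Suc k - 1) * ?g"
    using gauss_binom_absorb_both[of k n] by simp
  have "?u * (gauss_binom q n (Suc k) + q ^ (n - k) * gauss_binom q n k)
      = (q ^ (n - k) - 1) * ?g + q ^ (n - k) * ((q ^ Suc k - 1) * ?g)"
    unfolding 1[symmetric] 2[symmetric] by (simp only: distrib_left mult.left_commute)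
  also have "\<dots> = (q ^ (n - k + Suc k) - 1) * ?g"
    by (simp add: power_add algebra_simps)
  finally show ?thesis
    using u assms by simp
qed

lemma gauss_binom_Pascal':
  "gauss_binom q (Suc n) (Suc k) = q ^ Suc k * gauss_binom q n (Suc k) + gauss_binom q n k"
proof (cases "k \<le> n")
  case True
  let ?g = "gauss_binom q (Suc n) (Suc k)" and ?u = "q ^ Suc n - 1"
  have u: "?u \<noteq> 0"
    using power_neq_1[of "Suc n"] by simp
  have 1: "?u * gauss_binom q n (Suc k) = (q ^ (n - k) - 1) * ?g"
    using gauss_binom_absorb_upper[of "Suc k" n] True by simp
  have 2: "?u * gauss_binom q n k = (q ^ Suc k - 1) * ?g"
    using gauss_binom_absorb_both[of k n] by simp
  have "?u * (q ^ Suc k * gauss_binom q n (Suc k) + gauss_binom q n k)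
      = q ^ Suc k * ((q ^ (n - k) - 1) * ?g) + (q ^ Suc k - 1) * ?g"
    unfolding 1[symmetric] 2[symmetric] by (simp only: distrib_left mult.left_commute)
  also have "\<dots> = (q ^ (Suc k + (n - k)) - 1) * ?g"
    by (simp add: power_add algebra_simps)
  finally show ?thesis
    using u True by simp
qed simp

section \<open>Three-term recurrences\<close>

lemma polyB_gauss_binom: "polyB q n b d = (\<Sum>i\<le>n. gauss_binom q n i * b ^ i * d ^ (n - i))"
  unfolding polyB_def atLeast0AtMost by (rule sum.cong) (auto simp: gauss_binom_def)

lemma polyB_0 [simp]: "polyB q 0 b d = 1"
  by (simp add: polyB_gauss_binom)

lemma polyB_Suc_dilate: "polyB q (Suc n) b d = b * polyB q n b d + d * polyB q n (q * b) d"
proof -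
  have "polyB q (Suc n) b d
      = d ^ Suc n + (\<Sum>i\<le>n. gauss_binom q (Suc n) (Suc i) * b ^ Suc i * d ^ (n - i))"
    by (simp add: polyB_gauss_binom sum.atMost_Suc_shift del: sum.atMost_Suc power_Suc)
  also have "(\<Sum>i\<le>n. gauss_binom q (Suc n) (Suc i) * b ^ Suc i * d ^ (n - i))
      = b * polyB q n b d
        + (\<Sum>i\<le>n. gauss_binom q n (Suc i) * (q * b) ^ Suc i * d ^ (n - i))"
    unfolding gauss_binom_Pascal' polyB_gauss_binom sum_distrib_left sum.distrib[symmetric]
    by (rule sum.cong) (simp_all add: algebra_simps power_mult_distrib)
  also have "d ^ Suc n + (b * polyB q n b d
        + (\<Sum>i\<le>n. gauss_binom q n (Suc i) * (q * b) ^ Suc i * d ^ (n - i)))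
      = b * polyB q n b d + (\<Sum>i\<le>Suc n. gauss_binom q n i * (q * b) ^ i * d ^ (Suc n - i))"
    by (simp add: sum.atMost_Suc_shift del: sum.atMost_Suc power_Suc)
  also have "(\<Sum>i\<le>Suc n. gauss_binom q n i * (q * b) ^ i * d ^ (Suc n - i))
      = d * polyB q n (q * b) d"
    by (simp add: polyB_gauss_binom sum_distrib_left Suc_diff_le algebra_simps)
  finally show ?thesis .
qed

lemma polyB_dilate:
  "polyB q (Suc n) (q * b) d = polyB q (Suc n) b d + (q ^ Suc n - 1) * b * polyB q n b d"
proof -
  have "polyB q (Suc n) (q * b) d - polyB q (Suc n) b d
      = (\<Sum>i\<le>Suc n. (q ^ i - 1) * gauss_binom q (Suc n) i * b ^ i * d ^ (Suc n - i))"
    unfolding polyB_gauss_binom sum_subtractf[symmetric]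
    by (rule sum.cong) (simp_all add: algebra_simps power_mult_distrib)
  also have "\<dots> = (\<Sum>i\<le>n. (q ^ Suc i - 1) * gauss_binom q (Suc n) (Suc i) * b ^ Suc i * d ^ (n - i))"
    by (simp add: sum.atMost_Suc_shift del: sum.atMost_Suc power_Suc)
  also have "\<dots> = (q ^ Suc n - 1) * b * polyB q n b d"
    unfolding gauss_binom_absorb_both polyB_gauss_binom sum_distrib_left
    by (rule sum.cong) (simp_all add: algebra_simps)
  finally show ?thesis
    by (simp add: algebra_simps)
qed

lemma polyB_1: "polyB q (Suc 0) b d = b + d"
  by (simp add: polyB_Suc_dilate)

lemma polyB_recurrence:
  "polyB q (Suc (Suc n)) b d
    = (b + d) * polyB q (Suc n) b d + (q ^ Suc n - 1) * (b * d) * polyB q n b d"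
  unfolding polyB_Suc_dilate[of "Suc n"] polyB_dilate by (simp add: algebra_simps)

lemma polyA_eq_polyB: "polyA q n a c = polyB (1 / q) n a c"
  by (simp add: polyA_def polyB_def)

lemma polyA_0 [simp]: "polyA q 0 a c = 1"
  unfolding polyA_eq_polyB by (rule non_root_of_unity.polyB_0[OF non_root_of_unity_inverse])

lemma polyA_1: "polyA q (Suc 0) a c = a + c"
  unfolding polyA_eq_polyB by (rule non_root_of_unity.polyB_1[OF non_root_of_unity_inverse])

lemma polyA_recurrence:
  "q ^ Suc n * polyA q (Suc (Suc n)) a c
    = q ^ Suc n * (a + c) * polyA q (Suc n) a c - (q ^ Suc n - 1) * (a * c) * polyA q n a c"
proof -
  have "q ^ Suc n * ((1 / q) ^ Suc n - 1) = 1 - q ^ Suc n"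
    using nonzero by (simp add: power_divide field_simps)
  then show ?thesis
    unfolding polyA_eq_polyB non_root_of_unity.polyB_recurrence[OF non_root_of_unity_inverse]
    by (simp only: distrib_left mult.assoc[symmetric]) (simp add: algebra_simps)
qed

section \<open>Coefficients of \<open>F\<close>\<close>

context
  fixes a b c d :: 'a
begin

definition coeffF :: "nat \<Rightarrow> nat \<Rightarrow> 'a" where
  "coeffF m i = (-1) ^ i * gauss_binom q m i * q ^ (i choose 2)
                  * polyA q i a c * polyB q (m - i) b d"

lemma coeffF_B_part:
  "(b + d) * coeffF (Suc n) k + (q ^ Suc n - 1) * (b * d) * coeffF n k
    = (-1) ^ k * gauss_binom q (Suc n) k * q ^ (k choose 2)
        * polyA q k a c * polyB q (Suc (Suc n) - k) b d"
proof -
  consider "k \<le> n" | "k = Suc n" | "k > Suc n" by linarith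
  then show ?thesis
  proof cases
    case 1
    let ?s = "(-1) ^ k * q ^ (k choose 2) * polyA q k a c"
    have absorb: "(q ^ Suc n - 1) * gauss_binom q n k
        = (q ^ Suc (n - k) - 1) * gauss_binom q (Suc n) k"
      using gauss_binom_absorb_upper[of k n] 1 by (simp add: Suc_diff_le)
    have "(b + d) * coeffF (Suc n) k + (q ^ Suc n - 1) * (b * d) * coeffF n k
        = ?s * ((b + d) * gauss_binom q (Suc n) k * polyB q (Suc (n - k)) b d
          + ((q ^ Suc n - 1) * gauss_binom q n k) * (b * d) * polyB q (n - k) b d)"
      using 1 by (simp add: coeffF_def Suc_diff_le algebra_simps del: power_Suc)
    also have "\<dots> = ?s * gauss_binom q (Suc n) k * polyB q (Suc (Suc (n - k))) b d"
      unfolding absorb polyB_recurrence by (simp add: algebra_simps del: power_Suc)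
    finally show ?thesis
      using 1 by (simp add: Suc_diff_le mult_ac)
  next
    case 2
    then show ?thesis
      by (simp add: coeffF_def polyB_1 mult_ac)
  next
    case 3
    then show ?thesis
      by (simp add: coeffF_def)
  qed
qed

lemma Suc_choose_2: "Suc k choose 2 = k + (k choose 2)"
  by (simp add: numeral_2_eq_2)

lemma coeffF_A_part:
  "- (a + c) * q ^ Suc n * coeffF (Suc n) k
      - (q ^ Suc n - 1) * (a * c) * q ^ n * (if k = 0 then 0 else coeffF n (k - 1))
    = (-1) ^ Suc k * gauss_binom q (Suc n) k * q ^ (Suc n + (k choose 2))
        * polyA q (Suc k) a c * polyB q (Suc n - k) b d"
proof (cases k)
  case 0
  then show ?thesis
    by (simp add: coeffF_def polyA_1 algebra_simps numeral_2_eq_2)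
next
  case (Suc j)
  let ?s = "(-1) ^ j * q ^ n * q ^ (j choose 2) * polyB q (n - j) b d"
  have "- (a + c) * q ^ Suc n * coeffF (Suc n) k
      - (q ^ Suc n - 1) * (a * c) * q ^ n * (if k = 0 then 0 else coeffF n (k - 1))
    = ?s * (gauss_binom q (Suc n) (Suc j) * (q ^ Suc j * (a + c) * polyA q (Suc j) a c)
        - ((q ^ Suc n - 1) * gauss_binom q n j) * (a * c) * polyA q j a c)"
    by (simp add: Suc coeffF_def Suc_choose_2 power_add algebra_simps)
  also have "\<dots> = ?s * gauss_binom q (Suc n) (Suc j)
      * (q ^ Suc j * (a + c) * polyA q (Suc j) a c - (q ^ Suc j - 1) * (a * c) * polyA q j a c)"
    unfolding gauss_binom_absorb_both[symmetric] by (simp add: algebra_simps del: power_Suc)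
  also have "\<dots> = ?s * gauss_binom q (Suc n) (Suc j) * (q ^ Suc j * polyA q (Suc (Suc j)) a c)"
    unfolding polyA_recurrence ..
  finally show ?thesis
    by (simp add: Suc Suc_choose_2 power_add mult_ac)
qed

lemma coeffF_recurrence:
  "coeffF (Suc (Suc n)) (Suc k)
    = (b + d) * coeffF (Suc n) (Suc k) - (a + c) * q ^ Suc n * coeffF (Suc n) k
      + (q ^ Suc n - 1) * (b * d * coeffF n (Suc k)
          - a * c * q ^ n * (if k = 0 then 0 else coeffF n (k - 1)))"
  (is "_ = ?rhs")
proof -
  let ?s = "(-1) ^ Suc k * polyA q (Suc k) a c * polyB q (Suc n - k) b d"
  have "?rhs = ((b + d) * coeffF (Suc n) (Suc k) + (q ^ Suc n - 1) * (b * d) * coeffF n (Suc k))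
      + (- (a + c) * q ^ Suc n * coeffF (Suc n) k
      - (q ^ Suc n - 1) * (a * c) * q ^ n * (if k = 0 then 0 else coeffF n (k - 1)))"
    by (simp add: algebra_simps del: power_Suc)
  also have "\<dots> = ?s * (gauss_binom q (Suc n) (Suc k) * q ^ (Suc k choose 2)
      + gauss_binom q (Suc n) k * q ^ (Suc n + (k choose 2)))"
    unfolding coeffF_A_part coeffF_B_part by (simp add: algebra_simps del: power_Suc)
  also have "\<dots> = coeffF (Suc (Suc n)) (Suc k)"
  proof (cases "k \<le> Suc n")
    case True
    then have "q ^ (Suc n + (k choose 2)) = q ^ (Suc n - k) * q ^ (Suc k choose 2)"
      by (simp add: Suc_choose_2 flip: power_add)
    then show ?thesis
      by (simp add: coeffF_def gauss_binom_Pascal[OF True] algebra_simps del: power_Suc)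
  qed (simp add: coeffF_def)
  finally show ?thesis ..
qed

lemma coeff_polyF: "coeff (polyF a b c d q (int m)) k = coeffF m k"
proof (induction m arbitrary: k rule: less_induct)
  case (less m)
  consider "m = 0" | "m = 1" | n where "m = Suc (Suc n)"
    by (metis One_nat_def not0_implies_Suc)
  then show ?case
  proof cases
    case 1
    then show ?thesis
      by (cases k) (simp_all add: polyF.simps coeffF_def numeral_2_eq_2)
  next
    case 2
    have "coeffF 1 k = (if k = 0 then b + d else if k = 1 then - (a + c) else 0)"
      by (auto simp: coeffF_def polyA_1 polyB_1 numeral_2_eq_2)
    moreover have "polyF a b c d q 1 = [:b + d:] - monom (a + c) 1"
      by (subst polyF.simps) (simp add: polyF.simps[of _ _ _ _ _ 0] polyF.simps[of _ _ _ _ _ "-1"])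
    ultimately show ?thesis
      using 2 by (auto simp: coeff_pCons split: nat.splits)
  next
    case (3 n)
    have "polyF a b c d q (int m)
        = ([:b + d:] - monom ((a + c) * q ^ Suc n) 1) * polyF a b c d q (int (Suc n))
        + [:q ^ Suc n - 1:] * ([:b * d:] - monom (a * c * q ^ n) 2) * polyF a b c d q (int n)"
    proof -
      have "int m - 1 = int (Suc n)" "int m - 2 = int n" "\<not> int m < 0" "int m \<noteq> 0"
        using 3 by simp_all
      then show ?thesis
        by (subst polyF.simps) (simp only: if_False power_int_of_nat)
    qed
    then have "coeff (polyF a b c d q (int m)) k
        = (b + d) * coeffF (Suc n) k
          - (if 1 \<le> k then (a + c) * q ^ Suc n * coeffF (Suc n) (k - 1) else 0)
          + (q ^ Suc n - 1) * (b * d * coeffF n k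
            - (if 2 \<le> k then a * c * q ^ n * coeffF n (k - 2) else 0))"
      using 3 less[of n] less[of "Suc n"]
      by (simp add: left_diff_distrib right_diff_distrib coeff_monom_mult mult.assoc
          del: power_Suc of_nat_Suc)
    also have "\<dots> = coeffF m k"
    proof (cases k)
      case 0
      then show ?thesis
        using coeffF_B_part[of n 0] 3 by (simp add: coeffF_def algebra_simps)
    next
      case (Suc j)
      then show ?thesis
        using coeffF_recurrence[of n j] 3 by (cases j) (simp_all del: power_Suc)
    qed
    finally show ?thesis .
  qed
qed

end

lemma polyF_explicit:
  "polyF a b c d q (int m) =
    (\<Sum>i=0..m. monom ((-1) ^ i * qbinom q m i * q ^ (i choose 2)
                        * polyA q i a c * polyB q (m - i) b d) i)"
proof (rule poly_eqI)
  fix k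
  show "coeff (polyF a b c d q (int m)) k = coeff (\<Sum>i=0..m. monom ((-1) ^ i * qbinom q m i
      * q ^ (i choose 2) * polyA q i a c * polyB q (m - i) b d) i) k"
    by (simp add: coeff_polyF coeffF_def gauss_binom_def coeff_sum sum.delta)
qed

end

section \<open>The indeterminate \<open>q\<close>\<close>

lemma non_root_of_unity_indet_q: "non_root_of_unity (indet_q :: 'k::idom ratfun5)"
proof
  show "(indet_q :: 'k ratfun5) \<noteq> 0"
    by (simp add: indet_q_def Zero_fract_def eq_fract)
next
  fix n :: nat assume "n > 0"
  have "(indet_q :: 'k ratfun5) ^ n = Fract ([:0, 1:] ^ n) 1"
    by (induction n) (simp_all add: indet_q_def One_fract_def)
  moreover have "([:0, 1:] :: 'k poly poly poly poly poly) ^ n \<noteq> 1"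
  proof
    assume "([:0, 1:] :: 'k poly poly poly poly poly) ^ n = 1"
    then have "degree (([:0, 1:] :: 'k poly poly poly poly poly) ^ n) = 0"
      by simp
    with \<open>n > 0\<close> show False
      by (simp add: degree_power_eq)
  qed
  ultimately show "(indet_q :: 'k ratfun5) ^ n \<noteq> 1"
    by (simp add: One_fract_def eq_fract)
qed

theorem theorem7p7:
  fixes a b c d q :: "'k::idom ratfun5" and m :: nat
  assumes "a = indet_a" and "b = indet_b" and "c = indet_c" and "d = indet_d" and "q = indet_q"
  shows "polyF a b c d q (int m) =
    (\<Sum>i=0..m. monom ((-1) ^ i * qbinom q m i * q ^ (i choose 2)
                        * polyA q i a c * polyB q (m - i) b d) i)"
  unfolding assms(5) by (rule non_root_of_unity.polyF_explicit[OF non_root_of_unity_indet_q])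

end
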